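(* Let $z,w\in\mathbb{C}$ and $|\arg x|<\frac{\pi}{4}$. Then $$\frac{d^4}{dw^4}K_{z,w}(2x)+2x\left(\frac{d^2}{dw^2}K_{z+1,w}(2x)+\frac{d^2}{dw^2}K_{z-1,w}(2x)\right)+x^2\left(K_{z+2,w}(2x)-2K_{z,w}(2x)+K_{z-2,w}(2x)\right)=0.$$
   Context: The generalized modified Bessel function is defined, for $z,w\in\mathbb{C}$, by $$K_{z,w}(x):=\frac{1}{2\pi i}\int_{c-i\infty}^{c+i\infty}\Gamma\left(\tfrac{s-z}{2}\right)\Gamma\left(\tfrac{s+z}{2}\right)\,{}_1F_1\left(\tfrac{s-z}{2};\tfrac12;-\tfrac{w^2}{4}\right){}_1F_1\left(\tfrac{s+z}{2};\tfrac12;-\tfrac{w^2}{4}\right)2^{s-2}x^{-s}\,ds,$$ where $c=\mathrm{Re}(s)>|\mathrm{Re}(z)|$ and powers of $x$ are principal. Here ${}_1F_1(a;c;u)=\sum_{n\ge0}\frac{(a)_n u^n}{(c)_n n!}$ with $(a)_n=a(a+1)\cdots(a+n-1)$. *)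

theory Defs
  imports "HOL-Complex_Analysis.Complex_Analysis"
begin

definition hyp1F1 :: "complex \<Rightarrow> complex \<Rightarrow> complex \<Rightarrow> complex" where
  "hyp1F1 a c u = (\<Sum>n. pochhammer a n * u ^ n / (pochhammer c n * fact n))"

text \<open>
  The integral of \<open>f\<close> over the upward oriented line \<open>Re s = c\<close>, parametrised by
  \<open>s = c + i t\<close>, so that \<open>ds = i dt\<close>. It is taken as a Lebesgue integral: the
  integrand used below decays exponentially when \<open>\<bar>arg x\<bar> < pi / 2\<close>.
\<close>

definition vertical_integral :: "real \<Rightarrow> (complex \<Rightarrow> complex) \<Rightarrow> complex" where
  "vertical_integral c f = (\<integral>t. f (Complex c t) * \<i> \<partial>lborel)"

text \<open>
  The abscissa \<open>c\<close> of the line of integration is kept as a parameter; it is meant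
  to satisfy \<open>c > \<bar>Re z\<bar>\<close>.
\<close>

definition gen_bessel_K :: "real \<Rightarrow> complex \<Rightarrow> complex \<Rightarrow> complex \<Rightarrow> complex" where
  "gen_bessel_K c z w x =
     1 / (2 * of_real pi * \<i>) *
     vertical_integral c (\<lambda>s.
       Gamma ((s - z) / 2) * Gamma ((s + z) / 2) *
       hyp1F1 ((s - z) / 2) (1 / 2) (- (w\<^sup>2 / 4)) *
       hyp1F1 ((s + z) / 2) (1 / 2) (- (w\<^sup>2 / 4)) *
       2 powr (s - 2) * x powr (- s))"

text \<open>
  \<open>deriv\<close> is a total operator, so the existence of the iterated derivative has to be
  stated separately.
\<close>

definition differentiable_times :: "nat \<Rightarrow> (complex \<Rightarrow> complex) \<Rightarrow> complex \<Rightarrow> bool" where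
  "differentiable_times n f w \<longleftrightarrow> (\<forall>j<n. (deriv ^^ j) f field_differentiable at w)"

end

theory Submission
  imports Defs
begin

text \<open>
  For \<open>Re a > 0\<close> put \<open>\<phi>(a, v) = \<Gamma>(a) 1F1(a; 1/2; -v\<^sup>2/4)\<close>, which is the Mellin transform
  \<open>\<integral> t\<^bsup>a-1\<^esup> e\<^bsup>-t\<^esup> cos (v \<surd>t) dt\<close> over the positive half line. The cosine explains the one special
  function identity behind the theorem, with \<open>\<phi>\<close> called \<open>cosine_Gamma\<close> in the code: differentiating twice in \<open>v\<close> multiplies the
  transformed function by \<open>-t\<close>, so \<open>\<partial>\<^sup>2\<phi>(a, v) = -\<phi>(a + 1, v)\<close>. Here this is read off from
  the power series in \<open>v\<close> (\<open>deriv2_cosine_Gamma\<close>).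

  With \<open>a = (s - z)/2\<close> and \<open>b = (s + z)/2\<close>, the function \<open>K\<close> at \<open>2x\<close> is, up to the factor
  \<open>1/(8\<pi>i)\<close>, the integral of \<open>\<phi>(a, v) \<phi>(b, v) x\<^bsup>-s\<^esup>\<close> over a vertical line. Moving the line by
  the integer \<open>p + q\<close> turns \<open>x\<^bsup>p+q\<^esup>\<close> times the function of index \<open>z + q - p\<close> into the integral
  of \<open>\<phi>(a + p, v) \<phi>(b + q, v) x\<^bsup>-s\<^esup>\<close>. All terms of the equation therefore become integrals
  over one common line, and after differentiating under the integral sign their integrands
  cancel pointwise: writing \<open>f\<^sub>k = \<phi>(a + k)\<close> and \<open>g\<^sub>k = \<phi>(b + k)\<close>, the Leibniz rule with
  \<open>f\<^sub>k'' = -f\<^sub>k\<^sub>+\<^sub>1\<close> and \<open>g\<^sub>k'' = -g\<^sub>k\<^sub>+\<^sub>1\<close> gives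
  \<open>(f\<^sub>0g\<^sub>0)'''' + 2 ((f\<^sub>0g\<^sub>1)'' + (f\<^sub>1g\<^sub>0)'') + f\<^sub>0g\<^sub>2 - 2 f\<^sub>1g\<^sub>1 + f\<^sub>2g\<^sub>0 = 0\<close>
  (\<open>product_identity\<close>).

  Everything else is justification. Differentiation under the integral and the shift of the
  line both need exponential decay of \<open>\<phi>\<close> on vertical strips
  (\<open>cosine_Gamma_strip_decay\<close>): the Gamma function decays like \<open>e\<^bsup>-\<theta>\<bar>Im a\<bar>\<^esup>\<close> for every
  \<open>\<theta> < \<pi>/2\<close>, while the hypergeometric factor grows at most like \<open>e\<^bsup>\<epsilon>\<bar>a\<bar>\<^esup>\<close> for every
  \<open>\<epsilon> > 0\<close>. A rate \<open>\<pi>/4\<close> for each factor is enough: since \<open>\<bar>Im a\<bar> + \<bar>Im b\<bar> \<ge> \<bar>Im s\<bar>\<close>, it beats the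
  growth \<open>e\<^bsup>\<bar>arg x\<bar> \<bar>Im s\<bar>\<^esup>\<close> of \<open>x\<^bsup>-s\<^esup>\<close> when \<open>\<bar>arg x\<bar> < \<pi>/4\<close>.
\<close>

section \<open>Holomorphic families under the integral sign\<close>

text \<open>
  Domination is asked only locally in the parameter. That is what the strip argument below
  can offer, and Cauchy's estimate passes it on to the derivatives of the family.
\<close>

definition dominated_family ::
  "'a measure \<Rightarrow> complex set \<Rightarrow> ('a \<Rightarrow> complex \<Rightarrow> complex) \<Rightarrow> bool" where
  "dominated_family M S F \<longleftrightarrow>
     (\<forall>t\<in>space M. F t holomorphic_on S) \<and>
     (\<forall>w\<in>S. (\<lambda>t. F t w) \<in> borel_measurable M) \<and>
     (\<forall>w0\<in>S. \<exists>r>0. \<exists>g::'a \<Rightarrow> real. integrable M g \<and> ball w0 r \<subseteq> S \<and>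
        (\<forall>t\<in>space M. \<forall>w\<in>ball w0 r. norm (F t w) \<le> g t))"

lemma dominated_familyD:
  assumes "dominated_family M S F"
  shows dominated_family_holomorphic: "t \<in> space M \<Longrightarrow> F t holomorphic_on S"
    and dominated_family_measurable: "w \<in> S \<Longrightarrow> (\<lambda>t. F t w) \<in> borel_measurable M"
  using assms unfolding dominated_family_def by auto

lemma dominated_familyE:
  assumes "dominated_family M S F" "w0 \<in> S"
  obtains r g where "r > 0" "integrable M (g :: _ \<Rightarrow> real)" "ball w0 r \<subseteq> S"
    "\<And>t w. t \<in> space M \<Longrightarrow> w \<in> ball w0 r \<Longrightarrow> norm (F t w) \<le> g t"
  using assms unfolding dominated_family_def by meson

lemma dominated_family_integrable:
  assumes "dominated_family M S F" "w \<in> S"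
  shows "integrable M (\<lambda>t. F t w)"
proof -
  obtain r g where rg: "r > 0" "integrable M (g :: _ \<Rightarrow> real)"
    "\<And>t w'. t \<in> space M \<Longrightarrow> w' \<in> ball w r \<Longrightarrow> norm (F t w') \<le> g t"
    by (rule dominated_familyE[OF assms]) blast
  have bd: "norm (F t w) \<le> norm (g t)" if "t \<in> space M" for t
    using rg(3)[OF that, of w] rg(1) by simp
  show ?thesis
    by (rule Bochner_Integration.integrable_bound[OF rg(2)])
       (rule dominated_family_measurable[OF assms], rule AE_I2, rule bd)
qed

text \<open>
  Cauchy's estimate on discs of radius \<open>r/4\<close> around the points of the half-size ball trades
  the bound on the family for one on its derivative.
\<close>

lemma dominated_family_deriv_bound:
  assumes "dominated_family M S F" "w0 \<in> S"
  obtains r g where "r > 0" "integrable M (g :: _ \<Rightarrow> real)" "ball w0 r \<subseteq> S"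
    "\<And>t w. t \<in> space M \<Longrightarrow> w \<in> ball w0 r \<Longrightarrow> norm (deriv (F t) w) \<le> g t"
proof -
  obtain r g where rg: "r > 0" "integrable M (g :: _ \<Rightarrow> real)" "ball w0 r \<subseteq> S"
    "\<And>t w. t \<in> space M \<Longrightarrow> w \<in> ball w0 r \<Longrightarrow> norm (F t w) \<le> g t"
    by (rule dominated_familyE[OF assms]) blast
  show thesis
  proof (rule that[of "r/2" "\<lambda>t. g t / (r/4)"])
    show "r/2 > 0" "integrable M (\<lambda>t. g t / (r/4))" "ball w0 (r/2) \<subseteq> S"
      using rg by auto
    fix t w assume t: "t \<in> space M" and w: "w \<in> ball w0 (r/2)"
    have sub: "cball w (r/4) \<subseteq> ball w0 r"
    proof
      fix y assume "y \<in> cball w (r/4)"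
      then have "dist w y \<le> r/4" by simp
      moreover have "dist w0 w < r/2" using w by simp
      ultimately show "y \<in> ball w0 r"
        using dist_triangle[of w0 y w] rg(1) by simp
    qed
    have hol: "F t holomorphic_on cball w (r/4)"
      using dominated_family_holomorphic[OF assms(1) t] sub rg(3)
      by (meson holomorphic_on_subset subset_trans)
    have "norm ((deriv ^^ 1) (F t) w) \<le> fact 1 * g t / (r/4) ^ 1"
    proof (rule Cauchy_inequality)
      show "F t holomorphic_on ball w (r/4)"
        using hol by (rule holomorphic_on_subset) auto
      show "continuous_on (cball w (r/4)) (F t)"
        using hol by (rule holomorphic_on_imp_continuous_on)
      show "0 < r/4" using rg(1) by simp
      fix y assume "norm (w - y) = r/4"
      then have "y \<in> cball w (r/4)" by (simp add: dist_norm)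
      then show "norm (F t y) \<le> g t" using sub rg(4)[OF t] by blast
    qed
    then show "norm (deriv (F t) w) \<le> g t / (r/4)" by simp
  qed
qed

text \<open>
  Difference quotients are bounded by the supremum of the derivative, so dominated
  convergence applies to them along any sequence tending to \<open>w0\<close>. The measurability of the
  derivative comes out of the same limit.
\<close>

lemma dominated_family_diff_quotient:
  assumes F: "dominated_family M S F" and w0: "w0 \<in> S"
    and X: "X \<longlonglongrightarrow> w0" "\<And>n. X n \<noteq> w0"
  shows "(\<lambda>t. deriv (F t) w0) \<in> borel_measurable M"
    and "(\<lambda>n. ((\<integral>t. F t (X n) \<partial>M) - (\<integral>t. F t w0 \<partial>M)) / (X n - w0))
           \<longlonglongrightarrow> (\<integral>t. deriv (F t) w0 \<partial>M)"
proof -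
  obtain r g where rg: "r > 0" "integrable M (g :: _ \<Rightarrow> real)" "ball w0 r \<subseteq> S"
    "\<And>t w. t \<in> space M \<Longrightarrow> w \<in> ball w0 r \<Longrightarrow> norm (deriv (F t) w) \<le> g t"
    by (rule dominated_family_deriv_bound[OF F w0]) blast
  have "eventually (\<lambda>n. dist (X n) w0 < r) sequentially"
    using X(1) rg(1) by (simp add: tendsto_iff)
  then obtain N where N: "\<And>n. n \<ge> N \<Longrightarrow> dist (X n) w0 < r"
    by (auto simp: eventually_sequentially)
  \<comment> \<open>Dropping the first terms puts the whole sequence inside the ball where the bound holds.\<close>
  define Y where "Y = (\<lambda>n. X (n + N))"
  have Yb: "Y n \<in> ball w0 r" and Yne: "Y n \<noteq> w0" for n
    using N[of "n + N"] X(2) by (auto simp: Y_def dist_commute)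
  have Y: "Y \<longlonglongrightarrow> w0"
    unfolding Y_def using X(1) by (rule LIMSEQ_ignore_initial_segment)
  have YS: "Y n \<in> S" for n using Yb rg(3) by blast
  define Q where "Q = (\<lambda>n t. (F t (Y n) - F t w0) / (Y n - w0))"
  have Qm: "Q n \<in> borel_measurable M" for n
    unfolding Q_def
    using dominated_family_measurable[OF F YS[of n]] dominated_family_measurable[OF F w0]
    by measurable
  have der: "(F t has_field_derivative deriv (F t) w) (at w)"
    if "t \<in> space M" "w \<in> ball w0 r" for t w
  proof -
    have "F t holomorphic_on ball w0 r"
      using dominated_family_holomorphic[OF F that(1)] rg(3) by (rule holomorphic_on_subset)
    then show ?thesis using that(2) by (meson holomorphic_derivI open_ball)
  qed
  have Qlim: "(\<lambda>n. Q n t) \<longlonglongrightarrow> deriv (F t) w0" if t: "t \<in> space M" for t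
  proof -
    have "((\<lambda>y. (F t y - F t w0) / (y - w0)) \<longlongrightarrow> deriv (F t) w0) (at w0)"
      using der[OF t, of w0] rg(1) by (simp add: has_field_derivative_iff)
    moreover have "filterlim Y (at w0) sequentially"
      using Y Yne by (simp add: filterlim_at)
    ultimately show ?thesis
      unfolding Q_def by (rule filterlim_compose)
  qed
  show meas: "(\<lambda>t. deriv (F t) w0) \<in> borel_measurable M"
    by (rule borel_measurable_LIMSEQ_metric[OF Qm Qlim])
  have Qb: "norm (Q n t) \<le> g t" if t: "t \<in> space M" for n t
  proof -
    have "norm (F t (Y n) - F t w0) \<le> g t * norm (Y n - w0)"
    proof (rule field_differentiable_bound)
      show "convex (ball w0 r)" by simp
      show "(F t has_field_derivative deriv (F t) z) (at z within ball w0 r)" 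
        if "z \<in> ball w0 r" for z
        using der[OF t that] by (rule has_field_derivative_at_within)
    qed (use rg Yb t in auto)
    then show ?thesis
      using Yne[of n] by (simp add: Q_def norm_divide divide_le_eq)
  qed
  have "(\<lambda>n. integral\<^sup>L M (Q n)) \<longlonglongrightarrow> (\<integral>t. deriv (F t) w0 \<partial>M)"
    by (rule integral_dominated_convergence[OF meas Qm rg(2)])
       (auto intro: AE_I2 Qlim Qb)
  moreover have "integral\<^sup>L M (Q n) = ((\<integral>t. F t (Y n) \<partial>M) - (\<integral>t. F t w0 \<partial>M)) / (Y n - w0)" for n
    unfolding Q_def
    using dominated_family_integrable[OF F YS[of n]] dominated_family_integrable[OF F w0]
    by simp
  ultimately have "(\<lambda>n. ((\<integral>t. F t (X (n + N)) \<partial>M) - (\<integral>t. F t w0 \<partial>M)) / (X (n + N) - w0))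
           \<longlonglongrightarrow> (\<integral>t. deriv (F t) w0 \<partial>M)"
    by (simp add: Y_def)
  then show "(\<lambda>n. ((\<integral>t. F t (X n) \<partial>M) - (\<integral>t. F t w0 \<partial>M)) / (X n - w0))
           \<longlonglongrightarrow> (\<integral>t. deriv (F t) w0 \<partial>M)"
    by (rule LIMSEQ_offset)
qed

lemma dominated_family_has_field_derivative:
  assumes F: "dominated_family M S F" and w0: "w0 \<in> S"
  shows "((\<lambda>w. \<integral>t. F t w \<partial>M) has_field_derivative (\<integral>t. deriv (F t) w0 \<partial>M)) (at w0)"
  unfolding has_field_derivative_iff tendsto_at_iff_sequentially
  using dominated_family_diff_quotient(2)[OF F w0] by (auto simp: o_def)

lemma dominated_family_deriv:
  assumes F: "dominated_family M S F" and S: "open S"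
  shows "dominated_family M S (\<lambda>t. deriv (F t))"
  unfolding dominated_family_def
proof (intro conjI ballI)
  show "deriv (F t) holomorphic_on S" if "t \<in> space M" for t
    using dominated_family_holomorphic[OF F that] S by (rule holomorphic_deriv)
  show "(\<lambda>t. deriv (F t) w) \<in> borel_measurable M" if w: "w \<in> S" for w
  proof (rule dominated_family_diff_quotient(1)[OF F w])
    show "(\<lambda>n. w + of_real (inverse (real (Suc n)))) \<longlonglongrightarrow> w"
      using tendsto_add[OF tendsto_const[of w] tendsto_of_real[OF LIMSEQ_inverse_real_of_nat]]
      by simp
    show "w + of_real (inverse (real (Suc n))) \<noteq> w" for n
      by (simp add: field_simps del: of_nat_Suc)
  qed
  show "\<exists>r>0. \<exists>g::'a \<Rightarrow> real. integrable M g \<and> ball w0 r \<subseteq> S \<and>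
        (\<forall>t\<in>space M. \<forall>w\<in>ball w0 r. norm (deriv (F t) w) \<le> g t)" if "w0 \<in> S" for w0
    using dominated_family_deriv_bound[OF F that] by metis
qed

lemma dominated_family_higher_deriv:
  assumes F: "dominated_family M S F" and S: "open S"
  shows "dominated_family M S (\<lambda>t. (deriv ^^ n) (F t))"
  by (induction n) (auto intro: F dominated_family_deriv S)

lemma higher_deriv_integral:
  assumes F: "dominated_family M S F" and S: "open S" and w: "w \<in> S"
  shows "(deriv ^^ n) (\<lambda>w. \<integral>t. F t w \<partial>M) w = (\<integral>t. (deriv ^^ n) (F t) w \<partial>M)"
  using w
proof (induction n arbitrary: w)
  case (Suc n)
  have "((\<lambda>w. \<integral>t. (deriv ^^ n) (F t) w \<partial>M) has_field_derivative
          (\<integral>t. deriv ((deriv ^^ n) (F t)) w \<partial>M)) (at w)"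
    by (rule dominated_family_has_field_derivative
          [OF dominated_family_higher_deriv[OF F S] Suc.prems])
  then have "((deriv ^^ n) (\<lambda>w. \<integral>t. F t w \<partial>M) has_field_derivative
          (\<integral>t. deriv ((deriv ^^ n) (F t)) w \<partial>M)) (at w)"
    by (rule has_field_derivative_transform_within_open[OF _ S Suc.prems])
       (simp add: Suc.IH)
  then show ?case by (simp add: DERIV_imp_deriv)
qed simp

lemma holomorphic_integral:
  assumes F: "dominated_family M S F"
  shows "(\<lambda>w. \<integral>t. F t w \<partial>M) holomorphic_on S"
  using dominated_family_has_field_derivative[OF F]
  by (meson has_field_derivative_at_within holomorphic_on_def field_differentiable_def)

lemma integrable_exp_minus_abs:
  assumes "\<delta> > 0"
  shows "integrable lborel (\<lambda>t::real. exp (- \<delta> * \<bar>t\<bar>))"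
proof -
  have *: "integrable lborel (\<lambda>t::real. indicat_real {0..} t *\<^sub>R exp (- \<delta> * t))"
  proof -
    have "integrable lebesgue (\<lambda>t::real. indicat_real {0..} t *\<^sub>R exp (- \<delta> * t))" using assms
      by (intro nonnegative_absolutely_integrable_1 [unfolded set_integrable_def]
           integrable_on_exp_minus_to_infinity) auto
    then show ?thesis by (subst (asm) integrable_completion) auto
  qed
  have **: "integrable lborel (\<lambda>t::real. indicat_real {0..} (-t) *\<^sub>R exp (- \<delta> * (-t)))"
    using lborel_integrable_real_affine[OF *, of "-1" 0] by simp
  show ?thesis
    by (rule Bochner_Integration.integrable_bound[OF Bochner_Integration.integrable_add[OF * **]])
       (auto simp: indicator_def)
qed

text \<open>
  This replaces the usual contour shift over large rectangles. Regard the integral as a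
  function \<open>G\<close> of a complex base point \<open>\<zeta>\<close>, integrating \<open>f (\<zeta> + it)\<close> over real \<open>t\<close>. It is
  holomorphic by domination, and it does not change when \<open>\<zeta>\<close> moves vertically, because
  Lebesgue measure is translation invariant. So \<open>G\<close> has derivative zero and is constant on
  the half plane.
\<close>

lemma vertical_integrals_agree:
  assumes hol: "f holomorphic_on {s. m < Re s}"
    and decay: "\<And>\<alpha> \<beta>. m < \<alpha> \<Longrightarrow> \<exists>C. \<forall>s. \<alpha> \<le> Re s \<longrightarrow> Re s \<le> \<beta> \<longrightarrow> norm (f s) \<le> C * exp (- \<delta> * \<bar>Im s\<bar>)"
    and \<delta>: "\<delta> > 0" and c: "m < c" "m < c'"
  shows "(\<integral>t. f (Complex c t) \<partial>lborel) = (\<integral>t. f (Complex c' t) \<partial>lborel)"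
proof -
  define S where "S = {s. m < Re s}"
  define F where "F = (\<lambda>(t::real) \<zeta>. f (\<zeta> + \<i> * of_real t))"
  define G where "G = (\<lambda>\<zeta>. \<integral>t. F t \<zeta> \<partial>lborel)"
  have S: "open S" "convex S"
    unfolding S_def by (auto simp: open_halfspace_Re_gt convex_halfspace_Re_gt)
  have fam: "dominated_family lborel S F"
    unfolding dominated_family_def
  proof (intro conjI ballI)
    show "F t holomorphic_on S" for t
      unfolding F_def by (rule holomorphic_on_compose_gen[OF _ hol, unfolded o_def])
        (auto intro!: holomorphic_intros simp: S_def)
    show "(\<lambda>t. F t \<zeta>) \<in> borel_measurable lborel" if "\<zeta> \<in> S" for \<zeta>
    proof -
      have "continuous_on UNIV (\<lambda>t. f (\<zeta> + \<i> * of_real t))"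
        by (rule continuous_on_compose2[OF holomorphic_on_imp_continuous_on[OF hol]])
           (use that in \<open>auto intro!: continuous_intros simp: S_def\<close>)
      then show ?thesis unfolding F_def by (simp add: borel_measurable_continuous_onI)
    qed
    fix \<zeta>0 assume \<zeta>0: "\<zeta>0 \<in> S"
    \<comment> \<open>Half the distance to the boundary line, so that a closed strip around the ball stays inside.\<close>
    define r where "r = (Re \<zeta>0 - m) / 2"
    have r: "r > 0" "m < Re \<zeta>0 - r" using \<zeta>0 by (auto simp: r_def S_def field_simps)
    obtain C where C: "\<And>s. Re \<zeta>0 - r \<le> Re s \<Longrightarrow> Re s \<le> Re \<zeta>0 + r \<Longrightarrow>
        norm (f s) \<le> C * exp (- \<delta> * \<bar>Im s\<bar>)"
      using decay[OF r(2)] by blast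
    define K where "K = C * exp (\<delta> * (\<bar>Im \<zeta>0\<bar> + r))"
    have "C * exp (- \<delta> * \<bar>Im \<zeta>0\<bar>) \<ge> 0"
      using C[of \<zeta>0] r norm_ge_zero[of "f \<zeta>0"] by linarith
    then have C0: "C \<ge> 0" by (simp add: zero_le_mult_iff)
    have Re_Im: "\<bar>Re \<zeta> - Re \<zeta>0\<bar> < r" "\<bar>Im \<zeta> - Im \<zeta>0\<bar> < r" if "\<zeta> \<in> ball \<zeta>0 r" for \<zeta>
      using that abs_Re_le_cmod[of "\<zeta> - \<zeta>0"] abs_Im_le_cmod[of "\<zeta> - \<zeta>0"]
      by (auto simp: dist_norm norm_minus_commute)
    have "norm (F t \<zeta>) \<le> K * exp (- \<delta> * \<bar>t\<bar>)" if \<zeta>: "\<zeta> \<in> ball \<zeta>0 r" for t \<zeta>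
    proof -
      have "norm (F t \<zeta>) \<le> C * exp (- \<delta> * \<bar>Im \<zeta> + t\<bar>)"
        unfolding F_def using C[of "\<zeta> + \<i> * of_real t"] Re_Im[OF \<zeta>] by simp
      also have "\<dots> \<le> C * (exp (\<delta> * (\<bar>Im \<zeta>0\<bar> + r)) * exp (- \<delta> * \<bar>t\<bar>))"
      proof (intro mult_left_mono C0)
        have "\<bar>t\<bar> \<le> \<bar>Im \<zeta> + t\<bar> + (\<bar>Im \<zeta>0\<bar> + r)" using Re_Im[OF \<zeta>] by linarith
        then have "\<delta> * \<bar>t\<bar> \<le> \<delta> * (\<bar>Im \<zeta> + t\<bar> + (\<bar>Im \<zeta>0\<bar> + r))"
          using \<delta> by (intro mult_left_mono) auto
        then show "exp (- \<delta> * \<bar>Im \<zeta> + t\<bar>) \<le> exp (\<delta> * (\<bar>Im \<zeta>0\<bar> + r)) * exp (- \<delta> * \<bar>t\<bar>)"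
          by (simp add: exp_add[symmetric] algebra_simps)
      qed
      finally show ?thesis by (simp add: K_def)
    qed
    moreover have "ball \<zeta>0 r \<subseteq> S"
    proof
      fix \<zeta> assume "\<zeta> \<in> ball \<zeta>0 r"
      from Re_Im[OF this] r show "\<zeta> \<in> S" by (simp add: S_def)
    qed
    moreover have "integrable lborel (\<lambda>t. K * exp (- \<delta> * \<bar>t\<bar>))"
      using integrable_exp_minus_abs[OF \<delta>] by (intro integrable_mult_right)
    ultimately show "\<exists>r>0. \<exists>g::real \<Rightarrow> real. integrable lborel g \<and> ball \<zeta>0 r \<subseteq> S \<and>
        (\<forall>t\<in>space lborel. \<forall>w\<in>ball \<zeta>0 r. norm (F t w) \<le> g t)"
      using r(1) by (intro exI[of _ r] conjI exI[of _ "\<lambda>t. K * exp (- \<delta> * \<bar>t\<bar>)"]) auto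
  qed
  have der: "(G has_field_derivative deriv G \<zeta>) (at \<zeta>)" if "\<zeta> \<in> S" for \<zeta>
    using holomorphic_integral[OF fam] S(1) that unfolding G_def by (rule holomorphic_derivI)
  have translate: "G (\<zeta> + \<i> * of_real u) = G \<zeta>" for \<zeta> u
  proof -
    have "G (\<zeta> + \<i> * of_real u) = (\<integral>t. F (u + 1 * t) \<zeta> \<partial>lborel)"
      unfolding G_def F_def by (intro Bochner_Integration.integral_cong) (auto simp: algebra_simps)
    also have "\<dots> = G \<zeta>"
      using lborel_integral_real_affine[of 1 "\<lambda>t. F t \<zeta>" u] by (simp add: G_def)
    finally show ?thesis .
  qed
  \<comment> \<open>The derivative of \<open>G\<close> can be computed along the vertical direction, where \<open>G\<close> is constant.\<close>
  have zero: "(G has_field_derivative 0) (at \<zeta>)" if \<zeta>: "\<zeta> \<in> S" for \<zeta>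
  proof -
    have "((\<lambda>u. G (\<zeta> + \<i> * of_real u)) has_vector_derivative (\<i> * deriv G \<zeta>)) (at (0::real))"
    proof -
      have "((\<lambda>u::real. \<zeta> + \<i> * of_real u) has_vector_derivative \<i>) (at 0)"
        by (auto intro!: derivative_eq_intros simp: has_vector_derivative_def scaleR_conv_of_real)
      then show ?thesis
        using field_vector_diff_chain_at[of "\<lambda>u::real. \<zeta> + \<i> * of_real u" \<i> 0 G "deriv G \<zeta>"] der[OF \<zeta>]
        by (simp add: o_def)
    qed
    then have "((\<lambda>u::real. G \<zeta>) has_vector_derivative (\<i> * deriv G \<zeta>)) (at 0)"
      by (simp add: translate)
    then have "\<i> * deriv G \<zeta> = 0"
      using has_vector_derivative_const vector_derivative_unique_at by blast
    with der[OF \<zeta>] show ?thesis by simp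
  qed
  have "\<exists>k. \<forall>\<zeta>\<in>S. G \<zeta> = k"
    using has_field_derivative_zero_constant[OF S(2), of G] zero
    by (metis has_field_derivative_at_within)
  then have "G (of_real c) = G (of_real c')"
    using c by (auto simp: S_def)
  moreover have "of_real c + \<i> * of_real t = Complex c t" for c t
    by (simp add: complex_eq_iff)
  ultimately show ?thesis by (simp add: G_def F_def)
qed

section \<open>Growth of the hypergeometric factor\<close>

lemma power_le_fact_exp:
  fixes y :: real
  assumes "y \<ge> 0"
  shows "y ^ n \<le> fact n * exp y"
proof -
  have "(\<Sum>k\<in>{n}. y ^ k /\<^sub>R fact k) \<le> (\<Sum>k. y ^ k /\<^sub>R fact k)"
    using assms by (intro sum_le_suminf summable_exp_generic) auto
  then show ?thesis by (simp add: exp_def field_simps)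
qed

text \<open>
  The point of this bound is that the dependence on \<open>a\<close> is an exponential of arbitrarily
  small type, at the price of a geometric factor in \<open>n\<close> only. It follows from
  \<open>\<bar>pochhammer a n\<bar> \<le> (\<bar>a\<bar> + n)\<^sup>n\<close> and \<open>y\<^sup>n \<le> n! e\<^sup>y\<close> at \<open>y = \<epsilon> (\<bar>a\<bar> + n)\<close>.
\<close>

lemma norm_pochhammer_le:
  fixes a :: complex
  assumes "\<epsilon> > 0"
  shows "norm (pochhammer a n) \<le> fact n * (exp \<epsilon> / \<epsilon>) ^ n * exp (\<epsilon> * norm a)"
proof -
  have "norm (pochhammer a n) \<le> (\<Prod>i=0..<n. norm a + real n)"
    unfolding pochhammer_prod
    by (rule order.trans[OF norm_prod_le] prod_mono)+
       (auto intro!: order.trans[OF norm_triangle_ineq])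
  also have "\<dots> = (\<epsilon> * (norm a + real n)) ^ n / \<epsilon> ^ n"
    using assms by (simp add: power_mult_distrib)
  also have "\<dots> \<le> fact n * exp (\<epsilon> * (norm a + real n)) / \<epsilon> ^ n"
    using assms by (intro divide_right_mono power_le_fact_exp) auto
  also have "\<dots> = fact n * (exp \<epsilon> / \<epsilon>) ^ n * exp (\<epsilon> * norm a)"
    by (simp add: power_divide exp_of_nat2_mult exp_add algebra_simps)
  finally show ?thesis .
qed

lemma fact_square_le_fact_double: "(fact n :: real) * fact n \<le> fact (2 * n)"
proof -
  have "fact n * fact n \<le> (fact (n + n) :: nat)"
    by (intro dvd_imp_le fact_fact_dvd_fact) auto
  then have "real (fact n * fact n) \<le> real (fact (n + n))" by (simp only: of_nat_le_iff)
  then show ?thesis by (simp add: mult_2)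
qed

text \<open>
  The name recalls that \<open>\<Gamma>(a) hyp_cos a v\<close> is the Mellin transform of \<open>e\<^bsup>-t\<^esup> cos (v \<surd>t)\<close>:
  the coefficients below are those of the cosine, weighted by Pochhammer symbols.
\<close>

definition hyp_cos :: "complex \<Rightarrow> complex \<Rightarrow> complex" where
  "hyp_cos a v = hyp1F1 a (1 / 2) (- (v\<^sup>2 / 4))"

definition hyp_cos_coeff :: "complex \<Rightarrow> nat \<Rightarrow> complex" where
  "hyp_cos_coeff a n = (if even n then (-1) ^ (n div 2) * pochhammer a (n div 2) / fact n else 0)"

lemma hyp1F1_half_term:
  "pochhammer a n * (- (v\<^sup>2 / 4)) ^ n / (pochhammer (1 / 2) n * fact n) =
     hyp_cos_coeff a (2 * n) * v ^ (2 * n)"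
proof -
  have "pochhammer (1 / 2 :: complex) n * fact n = fact (2 * n) / 4 ^ n"
    by (simp add: fact_double power_mult)
  then show ?thesis
    by (simp add: hyp_cos_coeff_def power_minus[of "v\<^sup>2 / 4"] power_divide power_mult)
qed

text \<open>
  Since \<open>n! n! \<le> (2n)!\<close>, the denominator \<open>(2n)!\<close> leaves a factor \<open>1/n!\<close> after the factorial of the
  Pochhammer bound is used up, so the majorant is an exponential series.
\<close>

lemma norm_hyp_cos_term_le:
  assumes "\<epsilon> > 0"
  shows "norm (hyp_cos_coeff a (2 * n) * v ^ (2 * n)) \<le>
           exp (\<epsilon> * norm a) * ((exp \<epsilon> / \<epsilon> * (norm v)\<^sup>2) ^ n /\<^sub>R fact n)"
proof -
  have "norm (hyp_cos_coeff a (2 * n) * v ^ (2 * n)) =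
          norm (pochhammer a n) * ((norm v)\<^sup>2) ^ n / fact (2 * n)"
    by (simp add: hyp_cos_coeff_def norm_mult norm_divide norm_power power_mult)
  also have "\<dots> \<le> (fact n * (exp \<epsilon> / \<epsilon>) ^ n * exp (\<epsilon> * norm a)) * ((norm v)\<^sup>2) ^ n / (fact n * fact n)"
    using assms by (intro frac_le mult_right_mono norm_pochhammer_le fact_square_le_fact_double) auto
  also have "\<dots> = exp (\<epsilon> * norm a) * ((exp \<epsilon> / \<epsilon> * (norm v)\<^sup>2) ^ n /\<^sub>R fact n)"
    by (simp add: field_simps power_mult_distrib)
  finally show ?thesis .
qed

lemma summable_hyp_cos_even: "summable (\<lambda>n. hyp_cos_coeff a (2 * n) * v ^ (2 * n))"
proof (rule summable_comparison_test')
  show "summable (\<lambda>n. exp (1 * norm a) * ((exp 1 / 1 * (norm v)\<^sup>2) ^ n /\<^sub>R fact n))"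
    by (intro summable_mult summable_exp_generic)
  show "norm (hyp_cos_coeff a (2 * n) * v ^ (2 * n)) \<le>
          exp (1 * norm a) * ((exp 1 / 1 * (norm v)\<^sup>2) ^ n /\<^sub>R fact n)" if "n \<ge> 0" for n
    by (rule norm_hyp_cos_term_le) simp
qed

lemma hyp_cos_eq_even: "hyp_cos a v = (\<Sum>n. hyp_cos_coeff a (2 * n) * v ^ (2 * n))"
  unfolding hyp_cos_def hyp1F1_def hyp1F1_half_term ..

lemma norm_hyp_cos_le:
  assumes "\<epsilon> > 0"
  shows "norm (hyp_cos a v) \<le> exp (\<epsilon> * norm a) * exp (exp \<epsilon> / \<epsilon> * (norm v)\<^sup>2)"
proof -
  have "norm (hyp_cos a v) \<le> (\<Sum>n. exp (\<epsilon> * norm a) * ((exp \<epsilon> / \<epsilon> * (norm v)\<^sup>2) ^ n /\<^sub>R fact n))"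
    unfolding hyp_cos_eq_even
    by (intro norm_suminf_le summable_mult summable_exp_generic norm_hyp_cos_term_le assms)
  also have "\<dots> = exp (\<epsilon> * norm a) * exp (exp \<epsilon> / \<epsilon> * (norm v)\<^sup>2)"
    unfolding exp_def by (rule suminf_mult[OF summable_exp_generic])
  finally show ?thesis .
qed

lemma hyp_cos_sums: "(\<lambda>n. hyp_cos_coeff a n * v ^ n) sums hyp_cos a v"
proof -
  have "(\<lambda>n. hyp_cos_coeff a (2 * n) * v ^ (2 * n)) sums hyp_cos a v"
    unfolding hyp_cos_eq_even using summable_hyp_cos_even by (rule summable_sums)
  moreover have "hyp_cos_coeff a n * v ^ n = 0" if "n \<notin> range (\<lambda>n. 2 * n)" for n
    using that by (auto simp: hyp_cos_coeff_def elim!: evenE)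
  ultimately show ?thesis
    by (subst (asm) sums_mono_reindex[of "\<lambda>n. 2 * n"]) (auto simp: strict_mono_def)
qed

lemma holomorphic_hyp_cos_param: "(\<lambda>a. hyp_cos a v) holomorphic_on UNIV"
proof (rule holomorphic_uniform_sequence)
  show "(\<lambda>a. \<Sum>n<N. hyp_cos_coeff a (2 * n) * v ^ (2 * n)) holomorphic_on UNIV" for N
    unfolding hyp_cos_coeff_def pochhammer_prod by (auto intro!: holomorphic_intros)
  fix b :: complex
  have "uniform_limit (cball b 1) (\<lambda>N a. \<Sum>n<N. hyp_cos_coeff a (2 * n) * v ^ (2 * n))
          (\<lambda>a. \<Sum>n. hyp_cos_coeff a (2 * n) * v ^ (2 * n)) sequentially"
  proof (rule Weierstrass_m_test)
    show "summable (\<lambda>n. exp (1 * (norm b + 1)) * ((exp 1 / 1 * (norm v)\<^sup>2) ^ n /\<^sub>R fact n))"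
      by (intro summable_mult summable_exp_generic)
    fix n a assume "a \<in> cball b 1"
    then have "norm a \<le> norm b + 1"
      using norm_triangle_ineq2[of a b] by (simp add: dist_norm norm_minus_commute)
    then show "norm (hyp_cos_coeff a (2 * n) * v ^ (2 * n)) \<le> 
        exp (1 * (norm b + 1)) * ((exp 1 / 1 * (norm v)\<^sup>2) ^ n /\<^sub>R fact n)"
      by (intro order.trans[OF norm_hyp_cos_term_le[of 1]] mult_right_mono) auto
  qed
  then show "\<exists>d>0. cball b d \<subseteq> UNIV \<and>
      uniform_limit (cball b d) (\<lambda>N a. \<Sum>n<N. hyp_cos_coeff a (2 * n) * v ^ (2 * n))
        (\<lambda>a. hyp_cos a v) sequentially"
    unfolding hyp_cos_eq_even by (intro exI[of _ 1]) auto
qed auto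

text \<open>
  Two derivatives of the cosine series shift it by one even index, and
  \<open>pochhammer a (m + 1) = a pochhammer (a + 1) m\<close> absorbs that shift into the parameter.
\<close>

lemma diffs_diffs_hyp_cos_coeff:
  "diffs (diffs (hyp_cos_coeff a)) n = - a * hyp_cos_coeff (a + 1) n"
proof (cases "even n")
  case True
  then show ?thesis
  proof (elim evenE)
    fix m assume m: "n = 2 * m"
    have "of_nat (Suc n) \<noteq> (0::complex)" "of_nat (Suc (Suc n)) \<noteq> (0::complex)"
      by (simp_all only: of_nat_eq_0_iff)
    then show ?thesis
      by (simp add: m diffs_def hyp_cos_coeff_def pochhammer_rec divide_simps del: of_nat_Suc)
  qed
next
  case False
  then show ?thesis by (simp add: diffs_def hyp_cos_coeff_def)
qed

lemma hyp_cos_eq_powser: "hyp_cos a = (\<lambda>v. \<Sum>n. hyp_cos_coeff a n * v ^ n)"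
  using hyp_cos_sums by (auto simp: fun_eq_iff sums_iff)

lemma summable_hyp_cos: "summable (\<lambda>n. hyp_cos_coeff a n * v ^ n)"
  using hyp_cos_sums by (rule sums_summable)

lemma holomorphic_hyp_cos: "hyp_cos a holomorphic_on UNIV"
  unfolding hyp_cos_eq_powser holomorphic_on_def field_differentiable_def
  using termdiffs_strong_converges_everywhere[OF summable_hyp_cos] by blast

lemma deriv2_hyp_cos: "(deriv ^^ 2) (hyp_cos a) = (\<lambda>v. - a * hyp_cos (a + 1) v)"
proof -
  have "deriv (hyp_cos a) = (\<lambda>v. \<Sum>n. diffs (hyp_cos_coeff a) n * v ^ n)"
    unfolding hyp_cos_eq_powser
    by (intro ext DERIV_imp_deriv termdiffs_strong_converges_everywhere summable_hyp_cos)
  moreover have "deriv \<dots> = (\<lambda>v. \<Sum>n. diffs (diffs (hyp_cos_coeff a)) n * v ^ n)"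
    by (intro ext DERIV_imp_deriv termdiffs_strong_converges_everywhere
        termdiff_converges_all summable_hyp_cos)
  moreover have "\<dots> = (\<lambda>v. - a * hyp_cos (a + 1) v)"
    unfolding diffs_diffs_hyp_cos_coeff hyp_cos_eq_powser mult.assoc
    by (intro ext suminf_mult summable_hyp_cos)
  ultimately show ?thesis by (simp add: eval_nat_numeral)
qed

section \<open>Exponential decay of the Gamma function\<close>

text \<open>
  In Euler's limit formula \<open>\<bar>\<Gamma>(\<sigma> + i\<tau>)\<bar> / \<Gamma>(\<sigma>)\<close> is the limit of products of the factors
  \<open>(\<sigma> + k) / \<bar>\<sigma> + k + i\<tau>\<bar>\<close>, each of which increases with \<open>\<sigma>\<close>. The inequality is stated without
  quotients. It reduces decay in a strip to decay on a single line further to the right.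
\<close>

lemma norm_Gamma_ratio_mono:
  assumes "0 < \<sigma>" "\<sigma> \<le> \<rho>"
  shows "norm (Gamma (Complex \<sigma> \<tau>)) * Gamma \<rho> \<le> norm (Gamma (Complex \<rho> \<tau>)) * Gamma \<sigma>"
proof (rule LIMSEQ_le)
  show "(\<lambda>n. norm (Gamma_series (Complex \<sigma> \<tau>) n) * Gamma_series \<rho> n)
          \<longlonglongrightarrow> norm (Gamma (Complex \<sigma> \<tau>)) * Gamma \<rho>"
    by (intro tendsto_intros)
  show "(\<lambda>n. norm (Gamma_series (Complex \<rho> \<tau>) n) * Gamma_series \<sigma> n)
          \<longlonglongrightarrow> norm (Gamma (Complex \<rho> \<tau>)) * Gamma \<sigma>"
    by (intro tendsto_intros)
  have factor: "x * norm (Complex y \<tau>) \<le> y * norm (Complex x \<tau>)" if "0 < x" "x \<le> y" for x y :: real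
  proof (rule power2_le_imp_le)
    have "x\<^sup>2 * \<tau>\<^sup>2 \<le> y\<^sup>2 * \<tau>\<^sup>2" using that by (intro mult_right_mono power_mono) auto
    then show "(x * norm (Complex y \<tau>))\<^sup>2 \<le> (y * norm (Complex x \<tau>))\<^sup>2"
      by (simp add: power_mult_distrib cmod_power2 algebra_simps)
  qed (use that in auto)
  have poch: "norm (pochhammer (Complex x \<tau>) n) = (\<Prod>i=0..<n. norm (Complex (x + real i) \<tau>))" for x n
    unfolding pochhammer_prod prod_norm[symmetric] by (intro prod.cong arg_cong[where f = norm]) (auto simp: complex_eq_iff)
  have key: "norm (pochhammer (Complex \<rho> \<tau>) n) * pochhammer \<sigma> n \<le>
        norm (pochhammer (Complex \<sigma> \<tau>) n) * pochhammer \<rho> n" for n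
    unfolding poch unfolding pochhammer_prod prod.distrib[symmetric]
    using assms factor[of "\<sigma> + real i" "\<rho> + real i" for i]
    by (intro prod_mono) (auto simp: mult_ac)
  have "norm (Gamma_series (Complex \<sigma> \<tau>) n) * Gamma_series \<rho> n \<le>
          norm (Gamma_series (Complex \<rho> \<tau>) n) * Gamma_series \<sigma> n" for n
  proof -
    have pos: "pochhammer x (n + 1) > 0" "norm (pochhammer (Complex x \<tau>) (n + 1)) > 0" 
      if "x > 0" for x :: real
    proof -
      have "Complex x \<tau> \<noteq> - of_nat k" for k
        using that by (auto simp: complex_eq_iff)
      then have "pochhammer (Complex x \<tau>) (n + 1) \<noteq> 0"
        by (metis pochhammer_eq_0_iff)
      then show "norm (pochhammer (Complex x \<tau>) (n + 1)) > 0" by simp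
    qed (use that in \<open>simp add: pochhammer_pos\<close>)
    show ?thesis
      unfolding Gamma_series_def norm_divide norm_mult norm_exp_eq_Re
      using pos[of \<sigma>] pos[of \<rho>] assms key[of "n + 1"]
      by (simp add: field_simps del: pochhammer_Suc)
  qed
  then show "\<exists>N. \<forall>n\<ge>N. norm (Gamma_series (Complex \<sigma> \<tau>) n) * Gamma_series \<rho> n \<le>
          norm (Gamma_series (Complex \<rho> \<tau>) n) * Gamma_series \<sigma> n" by blast
qed

text \<open>
  On the critical line of the reflection formula \<open>1 - z\<close> is the conjugate of \<open>z\<close>, so the
  formula evaluates the modulus: \<open>\<bar>\<Gamma>(1/2 + i\<tau>)\<bar>\<^sup>2 = \<pi> / cosh (\<pi>\<tau>)\<close>.
\<close>

lemma norm_Gamma_half_le: "norm (Gamma (Complex (1/2) \<tau>)) \<le> sqrt (2 * pi) * exp (- (pi / 2) * \<bar>\<tau>\<bar>)"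
proof (rule power2_le_imp_le)
  define z where "z = Complex (1/2) \<tau>"
  have "of_real ((norm (Gamma z))\<^sup>2) = Gamma z * Gamma (1 - z)"
  proof -
    have "1 - z = cnj z" by (simp add: z_def complex_eq_iff)
    then show ?thesis by (simp only: cnj_Gamma[symmetric] complex_norm_square)
  qed
  also have "\<dots> = of_real pi / sin (of_real pi * z)"
    by (rule Gamma_reflection_complex)
  also have "sin (of_real pi * z) = cos (of_real pi / 2 - of_real pi * z)"
    by (simp add: sin_cos_eq)
  also have "of_real pi / 2 - of_real pi * z = - (\<i> * of_real (pi * \<tau>))"
    by (simp add: z_def complex_eq_iff)
  also have "cos (- (\<i> * of_real (pi * \<tau>))) = of_real (cosh (pi * \<tau>))"
    by (simp add: cosh_conv_cos[symmetric] cosh_def exp_of_real[symmetric] scaleR_conv_of_real flip: of_real_mult of_real_minus)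
  finally have "of_real ((norm (Gamma z))\<^sup>2) = complex_of_real (pi / cosh (pi * \<tau>))" by simp
  then have eq: "(norm (Gamma z))\<^sup>2 = pi / cosh (pi * \<tau>)"
    by (simp only: of_real_eq_iff)
  have "exp (pi * \<bar>\<tau>\<bar>) / 2 \<le> cosh (pi * \<tau>)"
    by (cases "\<tau> \<ge> 0") (auto simp: cosh_def abs_if)
  then have "pi / cosh (pi * \<tau>) \<le> pi / (exp (pi * \<bar>\<tau>\<bar>) / 2)"
    by (intro divide_left_mono) auto
  also have "\<dots> = (sqrt (2 * pi) * exp (- (pi / 2) * \<bar>\<tau>\<bar>))\<^sup>2"
    by (simp add: power_mult_distrib exp_minus field_simps flip: exp_double)
  finally show "(norm (Gamma (Complex (1/2) \<tau>)))\<^sup>2 \<le> (sqrt (2 * pi) * exp (- (pi / 2) * \<bar>\<tau>\<bar>))\<^sup>2"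
    using eq by (simp add: z_def)
qed auto

text \<open>
  The strip is compared with the line \<open>Re s = 1/2 + N\<close> to its right. The functional equation
  relates that line to \<open>Re s = 1/2\<close> through a Pochhammer symbol, whose growth costs an
  arbitrarily small part \<open>\<epsilon>\<close> of the rate \<open>\<pi>/2\<close>.
\<close>

lemma Gamma_strip_decay:
  assumes "0 < \<alpha>" "\<theta> < pi / 2"
  shows "\<exists>C\<ge>0. \<forall>s. \<alpha> \<le> Re s \<longrightarrow> Re s \<le> \<beta> \<longrightarrow> norm (Gamma s) \<le> C * exp (- \<theta> * \<bar>Im s\<bar>)"
proof -
  define \<epsilon> where "\<epsilon> = pi / 2 - \<theta>"
  have \<epsilon>: "\<epsilon> > 0" using assms by (simp add: \<epsilon>_def)
  obtain N :: nat where N: "\<beta> \<le> real N" using real_arch_simple by blast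
  define \<rho> where "\<rho> = 1/2 + real N"
  have \<rho>: "\<rho> > 0" by (simp add: \<rho>_def)
  have "compact (Gamma ` {\<alpha>..\<beta>})"
    using assms by (intro compact_continuous_image continuous_intros) (auto elim!: nonpos_Ints_cases)
  then obtain M where M: "\<And>\<sigma>. \<sigma> \<in> {\<alpha>..\<beta>} \<Longrightarrow> \<bar>Gamma \<sigma>\<bar> \<le> M"
    using compact_imp_bounded bounded_real by (metis imageI)
  define K where "K = sqrt (2 * pi) * (fact N * (exp \<epsilon> / \<epsilon>) ^ N * exp (\<epsilon> / 2))"
  have K: "K \<ge> 0" using \<epsilon> by (simp add: K_def)
  have shifted: "norm (Gamma (Complex \<rho> \<tau>)) \<le> K * exp (- \<theta> * \<bar>\<tau>\<bar>)" for \<tau>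
  proof -
    define z where "z = Complex (1/2) \<tau>"
    have z: "z \<notin> \<int>\<^sub>\<le>\<^sub>0" by (auto simp: z_def complex_eq_iff elim!: nonpos_Ints_cases)
    have "Gamma z \<noteq> 0" using z by (simp add: Gamma_eq_zero_iff)
    then have "Gamma (z + of_nat N) = Gamma z * pochhammer z N"
      using pochhammer_Gamma[OF z, of N] by simp
    moreover have "z + of_nat N = Complex \<rho> \<tau>" by (simp add: z_def \<rho>_def complex_eq_iff)
    ultimately have "norm (Gamma (Complex \<rho> \<tau>)) = norm (Gamma z) * norm (pochhammer z N)"
      by (simp add: norm_mult)
    also have "\<dots> \<le> (sqrt (2 * pi) * exp (- (pi / 2) * \<bar>\<tau>\<bar>)) *
        (fact N * (exp \<epsilon> / \<epsilon>) ^ N * exp (\<epsilon> * norm z))"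
      unfolding z_def using \<epsilon>
      by (intro mult_mono norm_Gamma_half_le norm_pochhammer_le) auto
    also have "\<dots> \<le> (sqrt (2 * pi) * exp (- (pi / 2) * \<bar>\<tau>\<bar>)) *
        (fact N * (exp \<epsilon> / \<epsilon>) ^ N * exp (\<epsilon> * (1/2 + \<bar>\<tau>\<bar>)))"
      using \<epsilon> cmod_le[of z] by (intro mult_left_mono) (auto simp: z_def)
    also have "\<dots> = K * (exp (- (pi / 2) * \<bar>\<tau>\<bar>) * exp (\<epsilon> * \<bar>\<tau>\<bar>))"
      by (simp add: K_def ring_distribs exp_add)
    also have "exp (- (pi / 2) * \<bar>\<tau>\<bar>) * exp (\<epsilon> * \<bar>\<tau>\<bar>) = exp (- \<theta> * \<bar>\<tau>\<bar>)"
      by (simp add: exp_add[symmetric] \<epsilon>_def algebra_simps)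
    finally show ?thesis .
  qed
  show ?thesis
  proof (intro exI[of _ "\<bar>M\<bar> * K / Gamma \<rho>"] conjI allI impI)
    show "\<bar>M\<bar> * K / Gamma \<rho> \<ge> 0" using K Gamma_real_pos[OF \<rho>] by simp
    fix s assume s: "\<alpha> \<le> Re s" "Re s \<le> \<beta>"
    have "norm (Gamma s) * Gamma \<rho> \<le> norm (Gamma (Complex \<rho> (Im s))) * Gamma (Re s)"
      using norm_Gamma_ratio_mono[of "Re s" \<rho> "Im s"] s assms N by (simp add: \<rho>_def)
    also have "\<dots> \<le> (K * exp (- \<theta> * \<bar>Im s\<bar>)) * \<bar>M\<bar>"
      using shifted M[of "Re s"] s K assms Gamma_real_pos[of "Re s"] by (intro mult_mono) auto
    finally show "norm (Gamma s) \<le> \<bar>M\<bar> * K / Gamma \<rho> * exp (- \<theta> * \<bar>Im s\<bar>)"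
      using Gamma_real_pos[OF \<rho>] by (simp add: field_simps)
  qed
qed

section \<open>The integrand on vertical strips\<close>

definition cosine_Gamma :: "complex \<Rightarrow> complex \<Rightarrow> complex" where
  "cosine_Gamma a v = Gamma a * hyp_cos a v"

lemma holomorphic_cosine_Gamma: "cosine_Gamma a holomorphic_on A"
  unfolding cosine_Gamma_def[abs_def]
  by (intro holomorphic_intros holomorphic_on_subset[OF holomorphic_hyp_cos]) auto

lemma holomorphic_cosine_Gamma_param: "(\<lambda>a. cosine_Gamma a v) holomorphic_on {a. 0 < Re a}"
  unfolding cosine_Gamma_def
  by (intro holomorphic_intros holomorphic_on_subset[OF holomorphic_hyp_cos_param])
     (auto elim!: nonpos_Ints_cases)

lemma deriv2_cosine_Gamma:
  assumes "0 < Re a"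
  shows "(deriv ^^ 2) (cosine_Gamma a) = (\<lambda>v. - cosine_Gamma (a + 1) v)"
proof
  fix v
  have a: "a \<notin> \<int>\<^sub>\<le>\<^sub>0" using assms by (auto elim!: nonpos_Ints_cases)
  have "(deriv ^^ 2) (cosine_Gamma a) v = Gamma a * (deriv ^^ 2) (hyp_cos a) v"
    unfolding cosine_Gamma_def[abs_def]
    by (rule higher_deriv_cmult[OF holomorphic_hyp_cos]) auto
  also have "\<dots> = - cosine_Gamma (a + 1) v"
    by (simp add: deriv2_hyp_cos cosine_Gamma_def Gamma_plus1[OF a])
  finally show "(deriv ^^ 2) (cosine_Gamma a) v = - cosine_Gamma (a + 1) v" .
qed

text \<open>
  The Gamma factor supplies the rate \<open>3\<pi>/8\<close>, of which the hypergeometric factor may consume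
  \<open>\<epsilon> = \<pi>/8\<close>.
\<close>

lemma cosine_Gamma_strip_decay:
  assumes "0 < \<alpha>"
  shows "\<exists>C\<ge>0. \<forall>a v. \<alpha> \<le> Re a \<longrightarrow> Re a \<le> \<beta> \<longrightarrow> norm v \<le> R \<longrightarrow>
           norm (cosine_Gamma a v) \<le> C * exp (- (pi / 4) * \<bar>Im a\<bar>)"
proof -
  define \<epsilon> where "\<epsilon> = pi / 8"
  have \<epsilon>: "\<epsilon> > 0" by (simp add: \<epsilon>_def)
  obtain C where C: "C \<ge> 0" "\<And>s. \<alpha> \<le> Re s \<Longrightarrow> Re s \<le> \<beta> \<Longrightarrow>
      norm (Gamma s) \<le> C * exp (- (3 * pi / 8) * \<bar>Im s\<bar>)"
    using Gamma_strip_decay[of \<alpha> "3 * pi / 8" \<beta>] assms by auto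
  define K where "K = exp (\<epsilon> * \<bar>\<beta>\<bar>) * exp (exp \<epsilon> / \<epsilon> * R\<^sup>2)"
  show ?thesis
  proof (intro exI[of _ "C * K"] conjI allI impI)
    show "C * K \<ge> 0" using C by (simp add: K_def)
    fix a v :: complex assume a: "\<alpha> \<le> Re a" "Re a \<le> \<beta>" and v: "norm v \<le> R"
    have "norm (hyp_cos a v) \<le> exp (\<epsilon> * norm a) * exp (exp \<epsilon> / \<epsilon> * (norm v)\<^sup>2)"
      by (rule norm_hyp_cos_le[OF \<epsilon>])
    also have "\<dots> \<le> exp (\<epsilon> * (\<bar>\<beta>\<bar> + \<bar>Im a\<bar>)) * exp (exp \<epsilon> / \<epsilon> * R\<^sup>2)"
      using cmod_le[of a] a v assms \<epsilon>
      by (intro mult_mono iffD2[OF exp_le_cancel_iff] mult_left_mono power_mono) auto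
    also have "\<dots> = K * exp (\<epsilon> * \<bar>Im a\<bar>)"
      by (simp add: K_def ring_distribs exp_add)
    finally have "norm (cosine_Gamma a v) \<le>
        (C * exp (- (3 * pi / 8) * \<bar>Im a\<bar>)) * (K * exp (\<epsilon> * \<bar>Im a\<bar>))"
      unfolding cosine_Gamma_def norm_mult using C a by (intro mult_mono) auto
    also have "\<dots> = C * K * (exp (- (3 * pi / 8) * \<bar>Im a\<bar>) * exp (\<epsilon> * \<bar>Im a\<bar>))"
      by simp
    also have "exp (- (3 * pi / 8) * \<bar>Im a\<bar>) * exp (\<epsilon> * \<bar>Im a\<bar>) = exp (- (pi / 4) * \<bar>Im a\<bar>)"
      by (simp add: \<epsilon>_def exp_add[symmetric] algebra_simps)
    finally show "norm (cosine_Gamma a v) \<le> C * K * exp (- (pi / 4) * \<bar>Im a\<bar>)" .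
  qed
qed

text \<open>
  At the argument \<open>2x\<close> the powers of \<open>2\<close> in the integrand of \<open>gen_bessel_K\<close> combine to the
  constant \<open>1/4\<close>, which is left out here.
\<close>

definition bessel_integrand :: "complex \<Rightarrow> complex \<Rightarrow> complex \<Rightarrow> complex \<Rightarrow> complex" where
  "bessel_integrand z x v s =
     cosine_Gamma ((s - z) / 2) v * cosine_Gamma ((s + z) / 2) v * x powr (- s)"

lemma gen_bessel_K_eq_integral:
  assumes "x \<noteq> 0"
  shows "gen_bessel_K c z v (2 * x) =
           1 / (8 * of_real pi) * (\<integral>t. bessel_integrand z x v (Complex c t) \<partial>lborel)"
proof -
  have pow: "2 powr (s - 2) * (2 * x) powr (- s) = x powr (- s) / 4" for s
  proof -
    have Ln2: "Ln (2 * x) = Ln 2 + Ln x"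
      using Ln_times_of_real[of 2 x] assms by (simp add: Ln_of_real[of 2, simplified])
    have "2 powr (s - 2) * (2 * x) powr (- s) = exp ((s - 2) * Ln 2 + (- s) * (Ln 2 + Ln x))"
      using assms by (simp only: powr_def Ln2 exp_add) simp
    also have "(s - 2) * Ln 2 + (- s) * (Ln 2 + Ln x) = - (2 * Ln 2) + (- s) * Ln x"
      by (simp only: ring_distribs) simp
    also have "exp \<dots> = exp (- (2 * Ln 2)) * x powr (- s)"
      using assms by (simp only: powr_def exp_add) simp
    also have "exp (- (2 * Ln 2)) = (1 / 4 :: complex)"
    proof -
      have "exp (2 * Ln 2 :: complex) = exp (Ln 2) ^ 2"
        using exp_of_nat_mult[of 2 "Ln 2 :: complex"] by simp
      then show ?thesis by (simp add: exp_minus)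
    qed
    finally show ?thesis by simp
  qed
  have integrand: "Gamma ((s - z) / 2) * Gamma ((s + z) / 2) *
       hyp1F1 ((s - z) / 2) (1 / 2) (- (v\<^sup>2 / 4)) *
       hyp1F1 ((s + z) / 2) (1 / 2) (- (v\<^sup>2 / 4)) *
       2 powr (s - 2) * (2 * x) powr (- s) = bessel_integrand z x v s / 4" for s
    using pow[of s] by (simp add: bessel_integrand_def cosine_Gamma_def hyp_cos_def mult.assoc)
  show ?thesis
    unfolding gen_bessel_K_def vertical_integral_def integrand by simp
qed

lemma norm_powr_minus:
  assumes "x \<noteq> 0"
  shows "norm (x powr (- s)) = exp (- Re s * ln (norm x) + Im s * Arg x)"
  using assms by (simp add: powr_def Arg_eq_Im_Ln)

text \<open>
  The imaginary parts of \<open>(s - z)/2\<close> and \<open>(s + z)/2\<close> add up to that of \<open>s\<close>, so the two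
  factors together decay at least at the rate \<open>\<pi>/4\<close> in \<open>\<bar>Im s\<bar>\<close>, whatever \<open>Im z\<close> is.
\<close>

lemma bessel_integrand_decay:
  assumes x: "x \<noteq> 0" and \<alpha>: "\<bar>Re z\<bar> < \<alpha>"
  shows "\<exists>C\<ge>0. \<forall>s v. \<alpha> \<le> Re s \<longrightarrow> Re s \<le> \<beta> \<longrightarrow> norm v \<le> R \<longrightarrow>
           norm (bessel_integrand z x v s) \<le> C * exp (- (pi / 4 - \<bar>Arg x\<bar>) * \<bar>Im s\<bar>)"
proof -
  have pos: "0 < (\<alpha> - \<bar>Re z\<bar>) / 2" using \<alpha> by simp
  obtain C where C: "C \<ge> 0" "\<And>a v. (\<alpha> - \<bar>Re z\<bar>) / 2 \<le> Re a \<Longrightarrow> Re a \<le> (\<beta> + \<bar>Re z\<bar>) / 2 \<Longrightarrow>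
      norm v \<le> R \<Longrightarrow> norm (cosine_Gamma a v) \<le> C * exp (- (pi / 4) * \<bar>Im a\<bar>)"
    using cosine_Gamma_strip_decay[OF pos, of "(\<beta> + \<bar>Re z\<bar>) / 2" R] by blast
  define K where "K = exp (\<bar>\<beta>\<bar> * \<bar>ln (norm x)\<bar>)"
  show ?thesis
  proof (intro exI[of _ "C * C * K"] conjI allI impI)
    show "C * C * K \<ge> 0" using C by (simp add: K_def)
    fix s v :: complex assume s: "\<alpha> \<le> Re s" "Re s \<le> \<beta>" and v: "norm v \<le> R"
    let ?a = "(s - z) / 2" and ?b = "(s + z) / 2"
    have a: "norm (cosine_Gamma ?a v) \<le> C * exp (- (pi / 4) * \<bar>Im ?a\<bar>)"
      by (rule C(2)) (use s v in \<open>auto simp: field_simps\<close>)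
    have b: "norm (cosine_Gamma ?b v) \<le> C * exp (- (pi / 4) * \<bar>Im ?b\<bar>)"
      by (rule C(2)) (use s v in \<open>auto simp: field_simps\<close>)
    have p: "norm (x powr (- s)) \<le> K * exp (\<bar>Arg x\<bar> * \<bar>Im s\<bar>)"
    proof -
      have "- Re s * ln (norm x) \<le> \<bar>Re s\<bar> * \<bar>ln (norm x)\<bar>"
        by (metis abs_ge_self abs_minus_cancel abs_mult)
      also have "\<dots> \<le> \<bar>\<beta>\<bar> * \<bar>ln (norm x)\<bar>" using s \<alpha> by (intro mult_right_mono) auto
      finally have "- Re s * ln (norm x) \<le> \<bar>\<beta>\<bar> * \<bar>ln (norm x)\<bar>" .
      moreover have "Im s * Arg x \<le> \<bar>Arg x\<bar> * \<bar>Im s\<bar>"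
        by (metis abs_ge_self abs_mult mult.commute)
      ultimately show ?thesis
        unfolding norm_powr_minus[OF x] K_def exp_add[symmetric] by simp
    qed
    have "norm (bessel_integrand z x v s) \<le>
        (C * exp (- (pi / 4) * \<bar>Im ?a\<bar>)) * (C * exp (- (pi / 4) * \<bar>Im ?b\<bar>)) * (K * exp (\<bar>Arg x\<bar> * \<bar>Im s\<bar>))"
      unfolding bessel_integrand_def norm_mult using a b p C by (intro mult_mono) auto
    also have "\<dots> = C * C * K * exp (- (pi / 4) * (\<bar>Im ?a\<bar> + \<bar>Im ?b\<bar>) + \<bar>Arg x\<bar> * \<bar>Im s\<bar>)"
      by (simp only: distrib_left exp_add mult_ac)
    also have "\<dots> \<le> C * C * K * exp (- (pi / 4 - \<bar>Arg x\<bar>) * \<bar>Im s\<bar>)"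
    proof -
      have "\<bar>Im s\<bar> \<le> \<bar>Im ?a\<bar> + \<bar>Im ?b\<bar>" by (simp add: field_simps)
      then have "(pi / 4) * \<bar>Im s\<bar> \<le> (pi / 4) * (\<bar>Im ?a\<bar> + \<bar>Im ?b\<bar>)" by (intro mult_left_mono) auto
      then show ?thesis
        using C by (intro mult_left_mono iffD2[OF exp_le_cancel_iff]) (auto simp: algebra_simps K_def)
    qed
    finally show "norm (bessel_integrand z x v s) \<le> C * C * K * exp (- (pi / 4 - \<bar>Arg x\<bar>) * \<bar>Im s\<bar>)" .
  qed
qed

lemma holomorphic_bessel_integrand_line:
  assumes "x \<noteq> 0"
  shows "bessel_integrand z x v holomorphic_on {s. \<bar>Re z\<bar> < Re s}"
  unfolding bessel_integrand_def[abs_def]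
  using assms
  by (intro holomorphic_on_mult holomorphic_on_powr_right holomorphic_intros
      holomorphic_on_compose_gen[OF _ holomorphic_cosine_Gamma_param, unfolded o_def]) auto

lemma holomorphic_bessel_integrand_arg:
  "(\<lambda>v. bessel_integrand z x v s) holomorphic_on A"
  unfolding bessel_integrand_def by (intro holomorphic_intros holomorphic_cosine_Gamma)

definition cosine_Gamma_product :: "complex \<Rightarrow> nat \<Rightarrow> nat \<Rightarrow> complex \<Rightarrow> complex \<Rightarrow> complex" where
  "cosine_Gamma_product z p q s v =
     cosine_Gamma ((s - z) / 2 + of_nat p) v * cosine_Gamma ((s + z) / 2 + of_nat q) v"

lemma holomorphic_cosine_Gamma_product: "cosine_Gamma_product z p q s holomorphic_on A"
  unfolding cosine_Gamma_product_def[abs_def] by (intro holomorphic_intros holomorphic_cosine_Gamma)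

context
  fixes x :: complex
  assumes x: "x \<noteq> 0" "\<bar>Arg x\<bar> < pi / 4"
begin

lemma bessel_integral_abscissa:
  assumes "\<bar>Re z\<bar> < c" "\<bar>Re z\<bar> < c'"
  shows "(\<integral>t. bessel_integrand z x v (Complex c t) \<partial>lborel) =
           (\<integral>t. bessel_integrand z x v (Complex c' t) \<partial>lborel)"
proof (rule vertical_integrals_agree[OF holomorphic_bessel_integrand_line _ _ assms])
  show "\<exists>C. \<forall>s. \<alpha> \<le> Re s \<longrightarrow> Re s \<le> \<beta> \<longrightarrow> norm (bessel_integrand z x v s) \<le>
          C * exp (- (pi / 4 - \<bar>Arg x\<bar>) * \<bar>Im s\<bar>)" if "\<bar>Re z\<bar> < \<alpha>" for \<alpha> \<beta>
    using bessel_integrand_decay[OF x(1) that, of \<beta> "norm v"] by blast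
qed (use x in auto)

lemma dominated_bessel_integrand:
  assumes c: "\<bar>Re z\<bar> < c"
  shows "dominated_family lborel UNIV (\<lambda>t v. bessel_integrand z x v (Complex c t))"
  unfolding dominated_family_def
proof (intro conjI ballI)
  show "(\<lambda>v. bessel_integrand z x v (Complex c t)) holomorphic_on UNIV" for t
    by (rule holomorphic_bessel_integrand_arg)
  show "(\<lambda>t. bessel_integrand z x v (Complex c t)) \<in> borel_measurable lborel" for v
  proof -
    have "continuous_on UNIV (\<lambda>t. bessel_integrand z x v (Complex c t))"
      by (rule continuous_on_compose2[OF holomorphic_on_imp_continuous_on
            [OF holomorphic_bessel_integrand_line[OF x(1)]]])
         (use c in \<open>auto intro!: continuous_intros simp: Complex_eq\<close>)
    then show ?thesis by (simp add: borel_measurable_continuous_onI)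
  qed
  fix w :: complex
  define \<delta> where "\<delta> = pi / 4 - \<bar>Arg x\<bar>"
  obtain C where C: "\<And>s v. c \<le> Re s \<Longrightarrow> Re s \<le> c \<Longrightarrow> norm v \<le> norm w + 1 \<Longrightarrow>
      norm (bessel_integrand z x v s) \<le> C * exp (- \<delta> * \<bar>Im s\<bar>)"
    using bessel_integrand_decay[OF x(1) c, of c "norm w + 1"] unfolding \<delta>_def by blast
  have "norm v \<le> norm w + 1" if "v \<in> ball w 1" for v
    using that norm_triangle_ineq2[of v w] by (simp add: dist_norm norm_minus_commute)
  then have "norm (bessel_integrand z x v (Complex c t)) \<le> C * exp (- \<delta> * \<bar>t\<bar>)" 
    if "v \<in> ball w 1" for t v
    using C[of "Complex c t" v] that by simp
  moreover have "integrable lborel (\<lambda>t. C * exp (- \<delta> * \<bar>t\<bar>))"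
    using x(2) by (intro integrable_mult_right integrable_exp_minus_abs) (simp add: \<delta>_def)
  ultimately show "\<exists>r>0. \<exists>g::real \<Rightarrow> real. integrable lborel g \<and> ball w r \<subseteq> UNIV \<and>
      (\<forall>t\<in>space lborel. \<forall>v\<in>ball w r. norm (bessel_integrand z x v (Complex c t)) \<le> g t)"
    by (intro exI[of _ 1] conjI exI[of _ "\<lambda>t. C * exp (- \<delta> * \<bar>t\<bar>)"]) auto
qed

lemma holomorphic_gen_bessel_K:
  assumes "\<bar>Re z\<bar> < c"
  shows "(\<lambda>v. gen_bessel_K c z v (2 * x)) holomorphic_on UNIV"
  unfolding gen_bessel_K_eq_integral[OF x(1)]
  by (intro holomorphic_intros holomorphic_integral dominated_bessel_integrand assms)

lemma gen_bessel_K_differentiable_times: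
  assumes "\<bar>Re z\<bar> < c"
  shows "differentiable_times n (\<lambda>v. gen_bessel_K c z v (2 * x)) w"
  unfolding differentiable_times_def
  using holomorphic_higher_deriv[OF holomorphic_gen_bessel_K[OF assms] open_UNIV]
  by (auto simp: holomorphic_on_def)

lemma shifted_bessel_integrand:
  "x ^ (p + q) * bessel_integrand (z + of_nat q - of_nat p) x v (s + of_nat (p + q)) =
     x powr (- s) * cosine_Gamma_product z p q s v"
proof -
  have "x ^ (p + q) = x powr of_nat (p + q)"
    using x(1) by (simp add: powr_nat del: of_nat_add)
  then have "x ^ (p + q) * x powr (- (s + of_nat (p + q))) = x powr (- s)"
    by (simp add: powr_add[symmetric] del: of_nat_add)
  then have pow: "x ^ (p + q) * (A * B * x powr (- (s + of_nat (p + q)))) = x powr (- s) * (A * B)" for A B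
    by (metis mult.commute mult.left_commute)
  have a: "(s + of_nat (p + q) - (z + of_nat q - of_nat p)) / 2 = (s - z) / 2 + of_nat p"
    and b: "(s + of_nat (p + q) + (z + of_nat q - of_nat p)) / 2 = (s + z) / 2 + of_nat q"
    by (simp_all add: field_simps)
  show ?thesis
    unfolding bessel_integrand_def cosine_Gamma_product_def a b by (rule pow)
qed

text \<open>
  Every term of the differential equation is brought to the line \<open>Re s = \<sigma>\<close>: the abscissa
  is first moved to \<open>\<sigma> + p + q\<close>, which is admissible for the index \<open>z + q - p\<close>, and the
  substitution \<open>s \<rightarrow> s + p + q\<close> then absorbs the power of \<open>x\<close>.
\<close>

lemma higher_deriv_gen_bessel_K:
  fixes n :: nat and w :: complex
  assumes c: "\<bar>Re (z + of_nat q - of_nat p)\<bar> < c" and \<sigma>: "\<bar>Re z\<bar> < \<sigma>"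
  defines "D \<equiv> \<lambda>t. x powr (- Complex \<sigma> t) * (deriv ^^ n) (cosine_Gamma_product z p q (Complex \<sigma> t)) w"
  shows "integrable lborel D"
    and "x ^ (p + q) * (deriv ^^ n) (\<lambda>v. gen_bessel_K c (z + of_nat q - of_nat p) v (2 * x)) w =
           1 / (8 * of_real pi) * (\<integral>t. D t \<partial>lborel)"
proof -
  define \<zeta> where "\<zeta> = z + of_nat q - of_nat p"
  define c' where "c' = \<sigma> + real (p + q)"
  have c': "\<bar>Re \<zeta>\<bar> < c'" using \<sigma> by (simp add: \<zeta>_def c'_def)
  define F where "F = (\<lambda>t v. bessel_integrand \<zeta> x v (Complex c' t))"
  have fam: "dominated_family lborel UNIV F"
    unfolding F_def by (rule dominated_bessel_integrand[OF c'])
  have K: "gen_bessel_K c \<zeta> v (2 * x) = 1 / (8 * of_real pi) * (\<integral>t. F t v \<partial>lborel)" for v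
    unfolding gen_bessel_K_eq_integral[OF x(1)] F_def
    using bessel_integral_abscissa[of \<zeta> c c' v] c c' by (simp add: \<zeta>_def)
  have Complex_c': "Complex c' t = Complex \<sigma> t + of_nat (p + q)" for t
    by (simp add: c'_def complex_eq_iff)
  have D: "D = (\<lambda>t. x ^ (p + q) * (deriv ^^ n) (F t) w)"
  proof
    fix t
    have "x ^ (p + q) * (deriv ^^ n) (F t) w = (deriv ^^ n) (\<lambda>v. x ^ (p + q) * F t v) w"
      unfolding F_def
      by (rule higher_deriv_cmult[OF holomorphic_bessel_integrand_arg[of _ _ _ UNIV], symmetric]) auto
    also have "(\<lambda>v. x ^ (p + q) * F t v) =
        (\<lambda>v. x powr (- Complex \<sigma> t) * cosine_Gamma_product z p q (Complex \<sigma> t) v)"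
      unfolding F_def \<zeta>_def Complex_c' by (rule ext, rule shifted_bessel_integrand)
    also have "(deriv ^^ n) \<dots> w = D t"
      unfolding D_def by (rule higher_deriv_cmult[OF holomorphic_cosine_Gamma_product[of _ _ _ _ UNIV]]) auto
    finally show "D t = x ^ (p + q) * (deriv ^^ n) (F t) w" ..
  qed
  show "integrable lborel D"
    unfolding D using dominated_family_integrable[OF dominated_family_higher_deriv[OF fam open_UNIV]]
    by (intro integrable_mult_right) auto
  have "(deriv ^^ n) (\<lambda>v. gen_bessel_K c \<zeta> v (2 * x)) w =
      1 / (8 * of_real pi) * (\<integral>t. (deriv ^^ n) (F t) w \<partial>lborel)"
    unfolding K higher_deriv_integral[OF fam open_UNIV UNIV_I, symmetric]
    by (rule higher_deriv_cmult[OF holomorphic_integral[OF fam] UNIV_I open_UNIV])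
  then show "x ^ (p + q) * (deriv ^^ n) (\<lambda>v. gen_bessel_K c (z + of_nat q - of_nat p) v (2 * x)) w =
           1 / (8 * of_real pi) * (\<integral>t. D t \<partial>lborel)"
    by (simp add: D \<zeta>_def)
qed

end

section \<open>The differential equation\<close>

text \<open>
  Expand with the Leibniz rule and use \<open>f0'''' = f2\<close>, \<open>f0''' = -f1'\<close>, and likewise for the
  \<open>g\<close>. The products without derivatives cancel as \<open>1 - 2 + 1\<close> for \<open>f2 g0\<close> and \<open>f0 g2\<close> and as
  \<open>6 - 4 - 2\<close> for \<open>f1 g1\<close>; the products of first derivatives cancel as \<open>-4 + 4\<close>.
\<close>

lemma product_identity:
  fixes f0 f1 f2 g0 g1 g2 :: "complex \<Rightarrow> complex"
  assumes hol: "f0 holomorphic_on UNIV" "f1 holomorphic_on UNIV" "f2 holomorphic_on UNIV"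
      "g0 holomorphic_on UNIV" "g1 holomorphic_on UNIV" "g2 holomorphic_on UNIV"
    and f: "(deriv ^^ 2) f0 = (\<lambda>v. - f1 v)" "(deriv ^^ 2) f1 = (\<lambda>v. - f2 v)"
    and g: "(deriv ^^ 2) g0 = (\<lambda>v. - g1 v)" "(deriv ^^ 2) g1 = (\<lambda>v. - g2 v)"
  shows "(deriv ^^ 4) (\<lambda>v. f0 v * g0 v) w
    + 2 * ((deriv ^^ 2) (\<lambda>v. f0 v * g1 v) w + (deriv ^^ 2) (\<lambda>v. f1 v * g0 v) w)
    + (f0 w * g2 w - 2 * (f1 w * g1 w) + f2 w * g0 w) = 0"
proof -
  have higher: "(deriv ^^ 3) h0 w = - deriv h1 w \<and> (deriv ^^ 4) h0 w = h2 w"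
    if "h1 holomorphic_on UNIV" "(deriv ^^ 2) h0 = (\<lambda>v. - h1 v)" "(deriv ^^ 2) h1 = (\<lambda>v. - h2 v)"
    for h0 h1 h2 :: "complex \<Rightarrow> complex"
  proof
    have minus: "(deriv ^^ n) (\<lambda>v. - h1 v) w = - (deriv ^^ n) h1 w" for n
      using higher_deriv_cmult[OF that(1), of w n "-1"] by simp
    have "(deriv ^^ 3) h0 w = (deriv ^^ 1) ((deriv ^^ 2) h0) w"
      "(deriv ^^ 4) h0 w = (deriv ^^ 2) ((deriv ^^ 2) h0) w"
      by (simp_all add: eval_nat_numeral)
    then show "(deriv ^^ 3) h0 w = - deriv h1 w" "(deriv ^^ 4) h0 w = h2 w"
      using minus[of 1] minus[of 2] that by simp_all
  qed
  note F = higher[OF hol(2) f] and G = higher[OF hol(5) g]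
  have leibniz2: "(deriv ^^ 2) (\<lambda>v. f v * g v) w =
      f w * (deriv ^^ 2) g w + 2 * deriv f w * deriv g w + (deriv ^^ 2) f w * g w"
    if "f holomorphic_on UNIV" "g holomorphic_on UNIV" for f g
    using higher_deriv_mult[OF that open_UNIV UNIV_I, of 2 w] by (simp add: eval_nat_numeral)
  have leibniz4: "(deriv ^^ 4) (\<lambda>v. f0 v * g0 v) w =
      f0 w * (deriv ^^ 4) g0 w + 4 * deriv f0 w * (deriv ^^ 3) g0 w +
      6 * (deriv ^^ 2) f0 w * (deriv ^^ 2) g0 w +
      4 * (deriv ^^ 3) f0 w * deriv g0 w + (deriv ^^ 4) f0 w * g0 w"
    using higher_deriv_mult[OF hol(1,4) open_UNIV UNIV_I, of 4 w] by (simp add: eval_nat_numeral)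
  show ?thesis
    unfolding leibniz4 leibniz2[OF hol(1,5)] leibniz2[OF hol(2,4)]
    using F G f g by (simp add: algebra_simps)
qed

lemma cosine_Gamma_product_identity:
  assumes "\<bar>Re z\<bar> < Re s"
  defines "P \<equiv> \<lambda>p q. cosine_Gamma_product z p q s"
  shows "(deriv ^^ 4) (P 0 0) w + 2 * ((deriv ^^ 2) (P 0 1) w + (deriv ^^ 2) (P 1 0) w)
    + (P 0 2 w - 2 * P 1 1 w + P 2 0 w) = 0"
proof -
  have D: "(deriv ^^ 2) (cosine_Gamma a) = (\<lambda>v. - cosine_Gamma (a + 1) v)"
    "(deriv ^^ 2) (cosine_Gamma (a + 1)) = (\<lambda>v. - cosine_Gamma (a + 2) v)" if "0 < Re a" for a
    using that deriv2_cosine_Gamma[of a] deriv2_cosine_Gamma[of "a + 1"] by (simp_all add: add.assoc)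
  have ab: "0 < Re ((s - z) / 2)" "0 < Re ((s + z) / 2)" using assms by auto
  show ?thesis
    using product_identity[OF holomorphic_cosine_Gamma holomorphic_cosine_Gamma holomorphic_cosine_Gamma
        holomorphic_cosine_Gamma holomorphic_cosine_Gamma holomorphic_cosine_Gamma
        D[OF ab(1)] D[OF ab(2)], of w]
    by (simp add: P_def cosine_Gamma_product_def[abs_def])
qed

theorem theorem1p14:
  fixes z w x :: complex and c :: "complex \<Rightarrow> real"
  assumes "x \<noteq> 0" and "\<bar>Arg x\<bar> < pi / 4"
    and "\<And>\<zeta>. c \<zeta> > \<bar>Re \<zeta>\<bar>"
  shows "differentiable_times 4 (\<lambda>v. gen_bessel_K (c z) z v (2 * x)) w
    \<and> differentiable_times 2 (\<lambda>v. gen_bessel_K (c (z + 1)) (z + 1) v (2 * x)) w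
    \<and> differentiable_times 2 (\<lambda>v. gen_bessel_K (c (z - 1)) (z - 1) v (2 * x)) w
    \<and> (deriv ^^ 4) (\<lambda>v. gen_bessel_K (c z) z v (2 * x)) w
       + 2 * x * ((deriv ^^ 2) (\<lambda>v. gen_bessel_K (c (z + 1)) (z + 1) v (2 * x)) w
                + (deriv ^^ 2) (\<lambda>v. gen_bessel_K (c (z - 1)) (z - 1) v (2 * x)) w)
       + x\<^sup>2 * (gen_bessel_K (c (z + 2)) (z + 2) w (2 * x)
              - 2 * gen_bessel_K (c z) z w (2 * x)
              + gen_bessel_K (c (z - 2)) (z - 2) w (2 * x)) = 0"
proof (intro conjI)
  show "differentiable_times 4 (\<lambda>v. gen_bessel_K (c z) z v (2 * x)) w"
    "differentiable_times 2 (\<lambda>v. gen_bessel_K (c (z + 1)) (z + 1) v (2 * x)) w"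
    "differentiable_times 2 (\<lambda>v. gen_bessel_K (c (z - 1)) (z - 1) v (2 * x)) w"
    using assms by (auto intro!: gen_bessel_K_differentiable_times)
  define \<sigma> where "\<sigma> = \<bar>Re z\<bar> + 1"
  have \<sigma>: "\<bar>Re z\<bar> < \<sigma>" by (simp add: \<sigma>_def)
  define D where "D = (\<lambda>p q n t. x powr (- Complex \<sigma> t) *
      (deriv ^^ n) (cosine_Gamma_product z p q (Complex \<sigma> t)) w)"
  define I where "I = (\<lambda>p q n. \<integral>t. D p q n t \<partial>lborel)"
  define J where "J = (\<lambda>p q n. 1 / (8 * of_real pi) * I p q n)"
  have int: "integrable lborel (D p q n)" for p q n
    unfolding D_def
    by (rule higher_deriv_gen_bessel_K(1)[OF assms(1,2) assms(3) \<sigma>])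
  have K: "x ^ (p + q) * (deriv ^^ n) (\<lambda>v. gen_bessel_K (c \<zeta>) \<zeta> v (2 * x)) w = J p q n"
    if "\<zeta> = z + of_nat q - of_nat p" for p q n \<zeta>
    unfolding J_def I_def D_def that
    by (rule higher_deriv_gen_bessel_K(2)[OF assms(1,2) assms(3) \<sigma>])
  have "D 0 0 4 t + 2 * (D 0 1 2 t + D 1 0 2 t) + (D 0 2 0 t - 2 * D 1 1 0 t + D 2 0 0 t) = 0" for t
  proof -
    have "D 0 0 4 t + 2 * (D 0 1 2 t + D 1 0 2 t) + (D 0 2 0 t - 2 * D 1 1 0 t + D 2 0 0 t) =
      x powr (- Complex \<sigma> t) * 0"
      unfolding cosine_Gamma_product_identity[of z "Complex \<sigma> t" w, simplified, OF \<sigma>, symmetric] D_def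
      by (simp add: algebra_simps)
    then show ?thesis by simp
  qed
  then have "0 = (\<integral>t. D 0 0 4 t + 2 * (D 0 1 2 t + D 1 0 2 t) +
      (D 0 2 0 t - 2 * D 1 1 0 t + D 2 0 0 t) \<partial>lborel)"
    by (simp only: integral_zero)
  also have "\<dots> = I 0 0 4 + 2 * (I 0 1 2 + I 1 0 2) + (I 0 2 0 - 2 * I 1 1 0 + I 2 0 0)"
    unfolding I_def
    by (simp only: Bochner_Integration.integral_add Bochner_Integration.integral_diff
        integral_mult_right_zero Bochner_Integration.integrable_add
        Bochner_Integration.integrable_diff integrable_mult_right int)
  finally have I: "I 0 0 4 + 2 * (I 0 1 2 + I 1 0 2) + (I 0 2 0 - 2 * I 1 1 0 + I 2 0 0) = 0" ..
  have "J 0 0 4 + 2 * (J 0 1 2 + J 1 0 2) + (J 0 2 0 - 2 * J 1 1 0 + J 2 0 0) =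
      1 / (8 * of_real pi) *
        (I 0 0 4 + 2 * (I 0 1 2 + I 1 0 2) + (I 0 2 0 - 2 * I 1 1 0 + I 2 0 0))"
    unfolding J_def by (simp only: ring_distribs mult.left_commute mult.assoc)
  then have total: "J 0 0 4 + 2 * (J 0 1 2 + J 1 0 2) + (J 0 2 0 - 2 * J 1 1 0 + J 2 0 0) = 0"
    by (simp only: I mult_zero_right)
  show "(deriv ^^ 4) (\<lambda>v. gen_bessel_K (c z) z v (2 * x)) w
       + 2 * x * ((deriv ^^ 2) (\<lambda>v. gen_bessel_K (c (z + 1)) (z + 1) v (2 * x)) w
                + (deriv ^^ 2) (\<lambda>v. gen_bessel_K (c (z - 1)) (z - 1) v (2 * x)) w)
       + x\<^sup>2 * (gen_bessel_K (c (z + 2)) (z + 2) w (2 * x)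
              - 2 * gen_bessel_K (c z) z w (2 * x)
              + gen_bessel_K (c (z - 2)) (z - 2) w (2 * x)) = 0"
    (is "?D4 + 2 * x * (?Dp + ?Dm) + x\<^sup>2 * (?Kp - 2 * ?K + ?Km) = 0")
  proof -
    have "?D4 + 2 * x * (?Dp + ?Dm) + x\<^sup>2 * (?Kp - 2 * ?K + ?Km) =
        ?D4 + 2 * (x * ?Dp + x * ?Dm) + (x\<^sup>2 * ?Kp - 2 * (x\<^sup>2 * ?K) + x\<^sup>2 * ?Km)"
      by (simp only: ring_distribs mult.assoc mult.left_commute)
    also have "\<dots> = 0"
      using K[of z 0 0 4] K[of "z + 1" 1 0 2] K[of "z - 1" 0 1 2]
        K[of "z + 2" 2 0 0] K[of z 1 1 0] K[of "z - 2" 0 2 0] total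
      by (simp add: power2_eq_square)
    finally show ?thesis .
  qed
qed

end
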